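(* Let $f:\mathbb{R}^d\to\mathbb{R}$ be a differentiable convex function. For any $T>0$, any $X_0\in\mathbb{R}^d$ and any $z\in\mathbb{R}^d$, let $(X_t,Y_t)_{t\in[0,T]}$ be the Hamiltonian flow trajectory of $f$ started from $(X_0,\mathbf{0})$ and let $$X^{\mathrm{avg}}(X_0;T)=\frac{2}{T^2}\int_0^T(T-t)X_t\,\mathrm{d}t.$$ Then $$f(X^{\mathrm{avg}}(X_0;T))-f(z)+\frac{1}{3T^2}\|X_T-z\|^2\le\frac{2}{3}(f(X_0)-f(z))+\frac{1}{3T^2}\|X_0-z\|^2.$$
   Context: The Hamiltonian flow of $f$ is the system $\dot X_t=Y_t$, $\dot Y_t=-\nabla f(X_t)$ on $\mathbb{R}^d\times\mathbb{R}^d$. Standing assumptions: $f$ has a unique minimizer, and for every initial condition the Hamiltonian flow admits a unique solution on $[0,\infty)$. *)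

theory Defs
  imports "HOL-Analysis.Analysis"
begin

(* Only meaningful where f is differentiable; see gderiv_grad. *)
definition grad :: "('a::euclidean_space \<Rightarrow> real) \<Rightarrow> 'a \<Rightarrow> 'a" where
  "grad f x = (THE g. GDERIV f x :> g)"

lemma grad_eqI:
  assumes "GDERIV f x :> g"
  shows "grad f x = g"
  unfolding grad_def
proof (rule the_equality)
  show "GDERIV f x :> g" by (fact assms)
next
  fix h assume "GDERIV f x :> h"
  with assms have "(\<lambda>v. v \<bullet> h) = (\<lambda>v. v \<bullet> g)"
    unfolding gderiv_def by (rule has_derivative_unique[symmetric])
  then have "\<And>v. v \<bullet> h = v \<bullet> g" by (rule fun_cong)
  then show "h = g" by (metis inner_commute vector_eq_rdot)
qed

lemma gderiv_grad:
  assumes "f differentiable (at x)"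
  shows "GDERIV f x :> grad f x"
proof -
  from assms obtain D where D: "(f has_derivative D) (at x)"
    unfolding differentiable_def by blast
  then have "linear D" by (rule has_derivative_linear)
  then have "D = (\<lambda>v. v \<bullet> adjoint D 1)"
    using adjoint_works[of D _ "1::real"] by auto
  with D have "GDERIV f x :> adjoint D 1"
    unfolding gderiv_def by simp
  then show ?thesis using grad_eqI by metis
qed

(* S is a time interval with left endpoint 0. The derivatives are taken within S,
   hence one-sided at the endpoints. *)
definition hamiltonian_trajectory ::
  "('a::euclidean_space \<Rightarrow> real) \<Rightarrow> real set \<Rightarrow> 'a \<Rightarrow> 'a \<Rightarrow> (real \<Rightarrow> 'a) \<Rightarrow> (real \<Rightarrow> 'a) \<Rightarrow> bool" where
  "hamiltonian_trajectory f S x0 y0 X Y \<longleftrightarrow>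
     X 0 = x0 \<and> Y 0 = y0 \<and>
     (\<forall>t\<in>S. (X has_vector_derivative Y t) (at t within S) \<and>
            (Y has_vector_derivative - grad f (X t)) (at t within S))"

(* Uniqueness is agreement on {0..}: values at negative times are irrelevant. *)
definition hamiltonian_flow_well_posed :: "('a::euclidean_space \<Rightarrow> real) \<Rightarrow> bool" where
  "hamiltonian_flow_well_posed f \<longleftrightarrow>
     (\<forall>x0 y0. (\<exists>X Y. hamiltonian_trajectory f {0..} x0 y0 X Y) \<and>
        (\<forall>X Y X' Y'. hamiltonian_trajectory f {0..} x0 y0 X Y \<longrightarrow>
                     hamiltonian_trajectory f {0..} x0 y0 X' Y' \<longrightarrow>
                     (\<forall>t\<ge>0. X t = X' t \<and> Y t = Y' t)))"

definition X_avg :: "(real \<Rightarrow> 'a::euclidean_space) \<Rightarrow> real \<Rightarrow> 'a" where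
  "X_avg X T = (2 / T\<^sup>2) *\<^sub>R integral {0..T} (\<lambda>t. (T - t) *\<^sub>R X t)"

end

theory Submission
  imports Defs
begin

text \<open>
  Write \<open>E = f(X\<^sub>0)\<close>. The motion starts at rest, so energy conservation
  (\<open>hamiltonian_energy_conserved\<close>) gives \<open>\<parallel>Y\<parallel>\<^sup>2 = 2 (E - f(X))\<close>, and the second derivative of
  \<open>\<phi> = \<parallel>X - z\<parallel>\<^sup>2 / 2\<close> is
  \<open>\<phi>'' = \<parallel>Y\<parallel>\<^sup>2 - \<langle>\<nabla>f(X), X - z\<rangle> \<le> 2 (E - f(X)) - (f(X) - f(z)) = 2 E + f(z) - 3 f(X)\<close>,
  the inequality being convexity (\<open>convex_above_tangent_hyperplane\<close>). Since \<open>\<phi>'(0) = 0\<close>, Taylor's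
  formula with integral remainder (\<open>squared_distance_taylor_remainder\<close>) expresses \<open>\<phi>(T) - \<phi>(0)\<close> as
  the integral of \<open>(T - t) \<phi>''(t)\<close> over \<open>[0, T]\<close>. Its weight is the one that defines the averaged
  position \<open>m\<close>, so by Jensen's inequality the integral of \<open>(T - t) f(X\<^sub>t)\<close> is at least
  \<open>f(m) T\<^sup>2 / 2\<close>. Hence \<open>\<phi>(T) - \<phi>(0) \<le> (2 E + f(z) - 3 f(m)) T\<^sup>2 / 2\<close>, and multiplication by
  \<open>2 / (3 T\<^sup>2)\<close> gives the claim.

  Jensen's inequality enters pointwise, by replacing \<open>f(X\<^sub>t)\<close> with its minorant, the tangent of \<open>f\<close> at
  \<open>m\<close>. The upper bound for \<open>\<phi>''\<close> is then a constant plus a linear function of \<open>X\<^sub>t - m\<close>, and the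
  weighted integral of the latter vanishes by the choice of \<open>m\<close> (\<open>X_avg_centered\<close>).
\<close>

text \<open>Restricting \<open>f\<close> to the line through \<open>x\<close> and \<open>y\<close> reduces this to the tangent inequality for
  convex functions of one real variable.\<close>
lemma convex_above_tangent_hyperplane:
  fixes f :: "'a::euclidean_space \<Rightarrow> real"
  assumes convex: "convex_on UNIV f" and deriv: "GDERIV f x :> g"
  shows "f x + (y - x) \<bullet> g \<le> f y"
proof -
  let ?h = "\<lambda>s::real. f (x + s *\<^sub>R (y - x))"
  have "convex_on UNIV ?h"
  proof (rule convex_onI)
    fix t a b :: real
    assume t: "0 < t" "t < 1"
    have eq: "x + ((1 - t) *\<^sub>R a + t *\<^sub>R b) *\<^sub>R (y - x)
        = (1 - t) *\<^sub>R (x + a *\<^sub>R (y - x)) + t *\<^sub>R (x + b *\<^sub>R (y - x))"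
      by (simp add: algebra_simps)
    show "?h ((1 - t) *\<^sub>R a + t *\<^sub>R b) \<le> (1 - t) * ?h a + t * ?h b"
      unfolding eq using t by (intro convex_onD[OF convex]) auto
  qed simp
  moreover have "(?h has_real_derivative (y - x) \<bullet> g) (at 0)"
  proof -
    have "((\<lambda>s::real. x + s *\<^sub>R (y - x)) has_derivative (\<lambda>s. s *\<^sub>R (y - x))) (at 0)"
      by (auto intro!: derivative_eq_intros)
    moreover have "(f has_derivative (\<lambda>v. v \<bullet> g)) (at (x + 0 *\<^sub>R (y - x)))"
      using deriv by (simp add: gderiv_def)
    ultimately have "(?h has_derivative (\<lambda>s. (s *\<^sub>R (y - x)) \<bullet> g)) (at 0)"
      by (rule has_derivative_compose)
    then show ?thesis
      by (simp add: has_field_derivative_def mult.commute[of _ "(y - x) \<bullet> g"] fun_eq_iff)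
  qed
  ultimately have "?h 1 - ?h 0 \<ge> ((y - x) \<bullet> g) * (1 - 0)"
    by (intro convex_on_imp_above_tangent[where A = UNIV]) auto
  then show ?thesis by simp
qed

lemma hamiltonian_energy_conserved:
  fixes f :: "'a::euclidean_space \<Rightarrow> real"
  assumes diff: "\<And>x. f differentiable (at x)"
    and traj: "hamiltonian_trajectory f {0..T} x0 y0 X Y"
    and t: "t \<in> {0..T}"
  shows "f (X t) + (Y t \<bullet> Y t) / 2 = f x0 + (y0 \<bullet> y0) / 2"
proof -
  let ?H = "\<lambda>t. f (X t) + (Y t \<bullet> Y t) / 2"
  have "(?H has_derivative (\<lambda>h. 0)) (at s within {0..T})" if s: "s \<in> {0..T}" for s
  proof -
    have X: "(X has_derivative (\<lambda>h. h *\<^sub>R Y s)) (at s within {0..T})"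
      and Y: "(Y has_derivative (\<lambda>h. h *\<^sub>R (- grad f (X s)))) (at s within {0..T})"
      using traj s by (auto simp: hamiltonian_trajectory_def has_vector_derivative_def)
    have "(f has_derivative (\<lambda>v. v \<bullet> grad f (X s))) (at (X s))"
      using gderiv_grad[OF diff] by (simp add: gderiv_def)
    from has_derivative_compose[OF X this]
    have "((\<lambda>t. f (X t)) has_derivative (\<lambda>h. (h *\<^sub>R Y s) \<bullet> grad f (X s))) (at s within {0..T})" .
    with Y show ?thesis
      by (auto simp: inner_commute intro!: derivative_eq_intros)
  qed
  then obtain c where "\<And>s. s \<in> {0..T} \<Longrightarrow> ?H s = c"
    using has_derivative_zero_constant[of "{0..T}" ?H] by auto
  moreover have "0 \<in> {0..T}" "X 0 = x0" "Y 0 = y0"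
    using t traj by (auto simp: hamiltonian_trajectory_def)
  ultimately show ?thesis using t by metis
qed

lemma has_integral_linear_weight:
  fixes T :: real
  assumes "0 \<le> T"
  shows "((\<lambda>t. T - t) has_integral T\<^sup>2 / 2) {0..T}"
proof -
  have "((\<lambda>t. T - t) has_integral (T * T - T\<^sup>2 / 2) - (T * 0 - 0\<^sup>2 / 2)) {0..T}"
    using assms
    by (intro fundamental_theorem_of_calculus)
       (auto intro!: derivative_eq_intros simp flip: has_real_derivative_iff_has_vector_derivative)
  then show ?thesis by (simp add: power2_eq_square field_simps)
qed

text \<open>The weight \<open>2 (T - t) / T\<^sup>2\<close> has total mass one, so \<open>X_avg X T\<close> is a barycentre of the trajectory.
  This is what annihilates the linear part of the tangent of \<open>f\<close> at that point.\<close>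
lemma X_avg_centered:
  fixes X :: "real \<Rightarrow> 'a::euclidean_space"
  assumes "T > 0" and cont: "continuous_on {0..T} X"
  shows "((\<lambda>t. (T - t) *\<^sub>R (X t - X_avg X T)) has_integral 0) {0..T}"
proof -
  let ?I = "integral {0..T} (\<lambda>t. (T - t) *\<^sub>R X t)"
  have "((\<lambda>t. (T - t) *\<^sub>R X t) has_integral ?I) {0..T}"
    by (intro integrable_integral integrable_continuous_real continuous_intros cont)
  moreover have "((\<lambda>t. (T - t) *\<^sub>R X_avg X T) has_integral (T\<^sup>2 / 2) *\<^sub>R X_avg X T) {0..T}"
    using has_integral_linear_weight[of T] assms by (intro has_integral_scaleR_left) auto
  ultimately have "((\<lambda>t. (T - t) *\<^sub>R X t - (T - t) *\<^sub>R X_avg X T)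
      has_integral ?I - (T\<^sup>2 / 2) *\<^sub>R X_avg X T) {0..T}"
    by (rule has_integral_diff)
  then show ?thesis
    using assms by (simp add: X_avg_def scaleR_right_diff_distrib)
qed

text \<open>
  Integration by parts is avoided by exhibiting the primitive \<open>t \<mapsto> (T - t) \<phi>'(t) + \<phi>(t)\<close> of the
  integrand, where \<open>\<phi>(t) = \<parallel>X t - z\<parallel>\<^sup>2 / 2\<close>. Zero initial velocity removes the term \<open>T \<phi>'(0)\<close>.
  The fundamental theorem of calculus for the Henstock-Kurzweil integral also provides the
  integrability of the remainder, which contains the derivative \<open>\<nabla>f(X)\<close> of \<open>-Y\<close>.
\<close>
lemma squared_distance_taylor_remainder:
  fixes f :: "'a::euclidean_space \<Rightarrow> real"
  assumes T: "0 \<le> T" and traj: "hamiltonian_trajectory f {0..T} x0 0 X Y"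
  shows "((\<lambda>t. (T - t) * (Y t \<bullet> Y t - (X t - z) \<bullet> grad f (X t)))
    has_integral ((norm (X T - z))\<^sup>2 - (norm (x0 - z))\<^sup>2) / 2) {0..T}"
proof -
  let ?G = "\<lambda>t. (T - t) * ((X t - z) \<bullet> Y t) + ((X t - z) \<bullet> (X t - z)) / 2"
  let ?G' = "\<lambda>t. (T - t) * (Y t \<bullet> Y t - (X t - z) \<bullet> grad f (X t))"
  have "(?G has_vector_derivative ?G' t) (at t within {0..T})" if t: "t \<in> {0..T}" for t
  proof -
    have X: "(X has_derivative (\<lambda>h. h *\<^sub>R Y t)) (at t within {0..T})"
      and Y: "(Y has_derivative (\<lambda>h. h *\<^sub>R (- grad f (X t)))) (at t within {0..T})"
      using traj t by (auto simp: hamiltonian_trajectory_def has_vector_derivative_def)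
    show ?thesis
      unfolding has_vector_derivative_def
      by (rule derivative_eq_intros X Y refl | simp)+
         (auto simp: fun_eq_iff inner_commute field_simps inner_diff_left inner_diff_right)
  qed
  then have "(?G' has_integral ?G T - ?G 0) {0..T}"
    using T by (intro fundamental_theorem_of_calculus) auto
  moreover have "X 0 = x0" "Y 0 = 0"
    using traj by (auto simp: hamiltonian_trajectory_def)
  ultimately show ?thesis
    by (simp add: power2_norm_eq_inner diff_divide_distrib)
qed

theorem corollary1:
  fixes f :: "real ^ 'd \<Rightarrow> real"
    and T :: real
    and X\<^sub>0 z :: "real ^ 'd"
    and X Y :: "real \<Rightarrow> real ^ 'd"
  assumes differentiable: "\<And>x. f differentiable (at x)"
    and convex: "convex_on UNIV f"
    and unique_minimizer: "\<exists>!m. \<forall>x. f m \<le> f x"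
    and well_posed: "hamiltonian_flow_well_posed f"
    and T_pos: "T > 0"
    and trajectory: "hamiltonian_trajectory f {0..T} X\<^sub>0 0 X Y"
  shows "f (X_avg X T) - f z + 1 / (3 * T\<^sup>2) * (norm (X T - z))\<^sup>2
           \<le> 2 / 3 * (f X\<^sub>0 - f z) + 1 / (3 * T\<^sup>2) * (norm (X\<^sub>0 - z))\<^sup>2"
proof -
  let ?m = "X_avg X T"
  let ?g = "grad f ?m"
  let ?C = "2 * f X\<^sub>0 + f z - 3 * f ?m"
  note tangent = convex_above_tangent_hyperplane[OF convex gderiv_grad[OF differentiable]]
  have second_deriv_bound:
    "Y t \<bullet> Y t - (X t - z) \<bullet> grad f (X t) \<le> ?C - 3 * ((X t - ?m) \<bullet> ?g)"
    if t: "t \<in> {0..T}" for t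
  proof -
    have "Y t \<bullet> Y t = 2 * (f X\<^sub>0 - f (X t))"
      using hamiltonian_energy_conserved[OF differentiable trajectory t] by simp
    moreover have "f (X t) - f z \<le> (X t - z) \<bullet> grad f (X t)"
      using tangent[of "X t" z] by (simp add: inner_diff_left)
    moreover have "f ?m + (X t - ?m) \<bullet> ?g \<le> f (X t)"
      by (rule tangent)
    ultimately show ?thesis by argo
  qed
  have "continuous_on {0..T} X"
    using trajectory
    by (auto simp: hamiltonian_trajectory_def continuous_on_eq_continuous_within
        intro: has_vector_derivative_continuous)
  from has_integral_linear[OF X_avg_centered[OF T_pos this] bounded_linear_inner_left[of ?g]]
  have "((\<lambda>t. (T - t) * ((X t - ?m) \<bullet> ?g)) has_integral 0) {0..T}"
    by (simp add: o_def)
  from has_integral_diff[OF has_integral_mult_left[OF has_integral_linear_weight, of T ?C]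
      has_integral_mult_right[OF this, of 3]]
  have "((\<lambda>t. (T - t) * (?C - 3 * ((X t - ?m) \<bullet> ?g))) has_integral T\<^sup>2 / 2 * ?C) {0..T}"
    using T_pos by (simp add: algebra_simps)
  with squared_distance_taylor_remainder[OF less_imp_le[OF T_pos] trajectory, of z]
  have "((norm (X T - z))\<^sup>2 - (norm (X\<^sub>0 - z))\<^sup>2) / 2 \<le> T\<^sup>2 / 2 * ?C"
    by (rule has_integral_le) (auto intro!: mult_left_mono second_deriv_bound)
  then have "1 / (3 * T\<^sup>2) * ((norm (X T - z))\<^sup>2 - (norm (X\<^sub>0 - z))\<^sup>2) \<le> ?C / 3"
    using T_pos by (simp add: field_simps)
  then show ?thesis
    by (simp add: algebra_simps diff_divide_distrib)
qed

end
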